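(* Let $K=2$, $0<v_1<v_2$, $\eta=v_1/v_2$, let $\alpha^*\in[0,1]$ be the probability of the high value $v_2$ in the aggregated market, and let $\beta\in[0,1]$ satisfy $\beta\le\min\{2\eta,2(1-\eta)\}$. Put $t^*=\frac{\eta-\beta/2}{1-\beta}$. Then the set $\mathcal S\subset\mathbb R^2$ of achievable (consumer, producer) expected utility pairs is the triangle $ABC$ given by $$A=\beta\mathbf c+(1-\beta)A',\quad A'=\Big[0,\ \alpha^*v_2+v_1\tfrac{(t^*-\alpha^* )_+}{t^*}\Big]^\top,$$ $$B=\beta\mathbf c+(1-\beta)B',\quad B'=\big[0,\ \alpha^*v_2+(1-\alpha^* )v_1\big]^\top,$$ $$C=\beta\mathbf c+(1-\beta)C',\quad C'=\Big[\alpha^*(v_2-v_1)-(v_2-v_1)\tfrac{(\alpha^*-t^* )_+}{1-t^*},\ v_1+(v_2-v_1)\tfrac{(\alpha^*-t^* )_+}{1-t^*}\Big]^\top,$$ where $$\mathbf c=\big[t^*\alpha^*(v_2-v_1),\ t^*v_1+(1-t^* )\alpha^*v_2\big]^\top$$ and $(z)_+=\max\{z,0\}$.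
   Context: Values are $\mathcal V=\{v_1,v_2\}$ with $0<v_1<v_2$. A market is a probability distribution $x$ on $\mathcal V$, identified with $\alpha=x(v_2)\in[0,1]$; $\mathcal X$ is the set of all markets and $\mathrm{Unif}(\mathcal X)$ the uniform distribution on it (i.e. $\alpha$ uniform on $[0,1]$). The aggregated market is $x^*=(1-\alpha^*,\alpha^* )$. A segmentation is a finitely supported probability distribution $\sigma$ on $\mathcal X$ with $\sum_x\sigma(x)x=x^*$; $\Sigma$ is the set of segmentations. For a price $p\ge0$ and market $x$: $\mathcal U_p(p,x)=p\sum_k x(v_k)\mathbf 1(p\le v_k)$ (producer) and $\mathcal U_c(p,x)=\sum_k x(v_k)(v_k-p)\mathbf 1(p\le v_k)$ (consumer). Privacy mechanism with parameter $\beta\in[0,1]$: $\mathcal M_\beta(x)$ equals $x$ with probability $1-\beta$ and, with probability $\beta$, is a draw from $\mathrm{Unif}(\mathcal X)$. The producer has prior $\mathrm{Unif}(\mathcal X)$ on each segment's market; after observing $\hat x$ the posterior is $\pi_\beta(\cdot|\hat x)=(1-\beta)\delta_{\hat x}+\beta\,\mathrm{Unif}(\mathcal X)$. Put $\mathcal U_p(p|\hat x)=\mathbb E_{x\sim\pi_\beta(\cdot|\hat x)}[\mathcal U_p(p,x)]$. A price $p$ is optimal given $\hat x$ if $\mathcal U_p(p|\hat x)\ge\mathcal U_p(p'|\hat x)$ for all $p'\ge0$ (optimal prices lie in $\mathcal V$). An optimal pricing rule is a map $\phi:\mathcal X\to\Delta(\mathcal V)$ such that for each $\hat x$ the support of $\phi(\hat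 x)$ consists only of prices optimal given $\hat x$. For $\bullet\in\{p,c\}$ let $U_\bullet^\phi(x)=\mathbb E_{\hat x\sim\mathcal M_\beta(x)}\mathbb E_{q\sim\phi(\hat x)}[\mathcal U_\bullet(q,x)]$. Then $$\mathcal S=\Big\{\big[\textstyle\sum_x\sigma(x)U_c^\phi(x),\ \sum_x\sigma(x)U_p^\phi(x)\big]^\top:\ \sigma\in\Sigma,\ \phi\text{ an optimal pricing rule}\Big\}.$$
   Formalization: The case β = 1 (possible only for η = 1/2), where t* = 0/0 is undefined, is excluded; when t* = 0 or t* = 1, a fraction of the form 0/0 in A' or C' is read as 0. *)

theory Defs
  imports "HOL-Probability.Probability"
begin

text \<open>
  Throughout, a market on the two values \<open>v\<^sub>1 < v\<^sub>2\<close> is represented by the probability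
  \<open>\<alpha> \<in> {0..1}\<close> of the high value; \<open>market v1 v2 \<alpha>\<close> is the distribution itself.
\<close>

definition market :: "real \<Rightarrow> real \<Rightarrow> real \<Rightarrow> real pmf" where
  "market v1 v2 \<alpha> = map_pmf (\<lambda>high. if high then v2 else v1) (bernoulli_pmf \<alpha>)"

definition producer_utility :: "real \<Rightarrow> real \<Rightarrow> real \<Rightarrow> real pmf \<Rightarrow> real" where
  "producer_utility v1 v2 p x = p * (\<Sum>v\<in>{v1, v2}. pmf x v * of_bool (p \<le> v))"

definition consumer_utility :: "real \<Rightarrow> real \<Rightarrow> real \<Rightarrow> real pmf \<Rightarrow> real" where
  "consumer_utility v1 v2 p x = (\<Sum>v\<in>{v1, v2}. pmf x v * (v - p) * of_bool (p \<le> v))"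

definition segmentations :: "real \<Rightarrow> real \<Rightarrow> real \<Rightarrow> real pmf set" where
  "segmentations v1 v2 \<alpha>s =
    {\<sigma>. finite (set_pmf \<sigma>) \<and> set_pmf \<sigma> \<subseteq> {0..1} \<and>
      (\<forall>v\<in>{v1, v2}. (\<Sum>\<alpha>\<in>set_pmf \<sigma>. pmf \<sigma> \<alpha> * pmf (market v1 v2 \<alpha>) v)
                       = pmf (market v1 v2 \<alpha>s) v)}"

text \<open>
  The underlying measurable space of markets is \<open>{0..1}\<close> itself rather than the whole real line,
  so that the behaviour of a pricing rule outside \<open>{0..1}\<close> cannot affect measurability.
\<close>

definition market_space :: "real measure" where
  "market_space = restrict_space borel {0..1}"

definition unif_market :: "real measure" where
  "unif_market = uniform_measure (restrict_space lborel {0..1}) {0..1}"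

definition mechanism :: "real \<Rightarrow> real \<Rightarrow> real measure" where
  "mechanism \<beta> \<alpha> = measure_pmf (bernoulli_pmf \<beta>) \<bind>
     (\<lambda>noise. if noise then unif_market else return market_space \<alpha>)"

text \<open>
  Bayes' rule for the uniform prior on markets gives a posterior of the same mixture form as the
  mechanism.
\<close>

definition posterior :: "real \<Rightarrow> real \<Rightarrow> real measure" where
  "posterior \<beta> \<alpha>h = measure_pmf (bernoulli_pmf \<beta>) \<bind>
     (\<lambda>noise. if noise then unif_market else return market_space \<alpha>h)"

definition posterior_producer_utility ::
    "real \<Rightarrow> real \<Rightarrow> real \<Rightarrow> real \<Rightarrow> real \<Rightarrow> real" where
  "posterior_producer_utility v1 v2 \<beta> p \<alpha>h =
     (LINT \<alpha>|posterior \<beta> \<alpha>h. producer_utility v1 v2 p (market v1 v2 \<alpha>))"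

definition optimal_price :: "real \<Rightarrow> real \<Rightarrow> real \<Rightarrow> real \<Rightarrow> real \<Rightarrow> bool" where
  "optimal_price v1 v2 \<beta> \<alpha>h p \<longleftrightarrow> p \<ge> 0 \<and>
     (\<forall>p'\<ge>0. posterior_producer_utility v1 v2 \<beta> p \<alpha>h
               \<ge> posterior_producer_utility v1 v2 \<beta> p' \<alpha>h)"

definition optimal_pricing_rule ::
    "real \<Rightarrow> real \<Rightarrow> real \<Rightarrow> (real \<Rightarrow> real pmf) \<Rightarrow> bool" where
  "optimal_pricing_rule v1 v2 \<beta> \<phi> \<longleftrightarrow>
     (\<forall>\<alpha>h\<in>{0..1}. set_pmf (\<phi> \<alpha>h) \<subseteq> {v1, v2} \<and>
        (\<forall>p\<in>set_pmf (\<phi> \<alpha>h). optimal_price v1 v2 \<beta> \<alpha>h p))"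

definition expected_producer_utility ::
    "real \<Rightarrow> real \<Rightarrow> real \<Rightarrow> (real \<Rightarrow> real pmf) \<Rightarrow> real \<Rightarrow> real" where
  "expected_producer_utility v1 v2 \<beta> \<phi> \<alpha> =
     (LINT \<alpha>h|mechanism \<beta> \<alpha>.
        measure_pmf.expectation (\<phi> \<alpha>h) (\<lambda>q. producer_utility v1 v2 q (market v1 v2 \<alpha>)))"

definition expected_consumer_utility ::
    "real \<Rightarrow> real \<Rightarrow> real \<Rightarrow> (real \<Rightarrow> real pmf) \<Rightarrow> real \<Rightarrow> real" where
  "expected_consumer_utility v1 v2 \<beta> \<phi> \<alpha> =
     (LINT \<alpha>h|mechanism \<beta> \<alpha>.
        measure_pmf.expectation (\<phi> \<alpha>h) (\<lambda>q. consumer_utility v1 v2 q (market v1 v2 \<alpha>)))"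

definition achievable :: "real \<Rightarrow> real \<Rightarrow> real \<Rightarrow> real \<Rightarrow> (real \<times> real) set" where
  "achievable v1 v2 \<beta> \<alpha>s =
     {(\<Sum>\<alpha>\<in>set_pmf \<sigma>. pmf \<sigma> \<alpha> * expected_consumer_utility v1 v2 \<beta> \<phi> \<alpha>,
       \<Sum>\<alpha>\<in>set_pmf \<sigma>. pmf \<sigma> \<alpha> * expected_producer_utility v1 v2 \<beta> \<phi> \<alpha>) | \<sigma> \<phi>.
      \<sigma> \<in> segmentations v1 v2 \<alpha>s \<and> optimal_pricing_rule v1 v2 \<beta> \<phi>}"

end

theory Submission
  imports Defs
begin

text \<open>
  The posterior mean of the high-value probability is affine in the report, so the low price is
  optimal exactly up to the threshold \<open>t\<close> and the high price exactly from \<open>t\<close> on; pricing rules differ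
  only in how they break the tie at \<open>t\<close>. A noisy report does not depend on the segment, hence it
  contributes the fixed vector \<open>c\<close> and the tie (a null event) does not matter. For a truthful report
  the utilities depend affinely on two numbers: the probability that the low price is charged and
  the probability that it is charged to a buyer of high value. The achievable pairs form a polygon
  with the three claimed vertices, and every point of it is attained by a segmentation supported
  on \<open>{0, t, 1}\<close>.
\<close>

section \<open>Integrals over the uniform market and the mechanism\<close>

lemma unif_market_eq: "unif_market = restrict_space lborel {0..1}"
proof (rule measure_eqI)
  show "sets unif_market = sets (restrict_space lborel {0..1})"
    by (simp add: unif_market_def)
  fix X assume "X \<in> sets unif_market"
  then have X: "X \<in> sets (restrict_space lborel {0..1::real})"
    by (simp add: unif_market_def)
  then have "X \<subseteq> {0..1}"
    by (auto simp: sets_restrict_space)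
  \<comment> \<open>The interval has length 1, so dividing by its measure changes nothing.\<close>
  moreover have "emeasure (restrict_space lborel {0..1}) {0..1::real} = 1"
    by (subst emeasure_restrict_space) auto
  ultimately show "emeasure unif_market X = emeasure (restrict_space lborel {0..1}) X"
    using X unfolding unif_market_def
    by (subst emeasure_uniform_measure) (auto simp: Int_absorb1 sets_restrict_space_iff divide_ennreal_def)
qed

lemma sets_unif_market: "sets unif_market = sets market_space"
  by (simp add: unif_market_eq market_space_def sets_restrict_space)

lemma space_market_space: "space market_space = {0..1}"
  by (simp add: market_space_def space_restrict_space)

lemma prob_space_unif_market: "prob_space unif_market"
  by (rule prob_spaceI) (simp add: unif_market_eq space_restrict_space emeasure_restrict_space)

text \<open>The mechanism is a mixture, so an integral splits into its noisy and truthful parts. The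
  splitting is done for the nonnegative integral; the bounds on \<open>f\<close> make it finite and
  allow the return to the Bochner integral. The posterior is the same mixture, so the lemma serves
  it as well.\<close>

lemma integral_mechanism:
  fixes f :: "real \<Rightarrow> real"
  assumes f: "f \<in> borel_measurable market_space"
    and bounds: "\<And>x. x \<in> {0..1} \<Longrightarrow> 0 \<le> f x \<and> f x \<le> K"
    and "\<alpha> \<in> {0..1}" "\<beta> \<in> {0..1}"
  shows "integral\<^sup>L (mechanism \<beta> \<alpha>) f = \<beta> * integral\<^sup>L unif_market f + (1 - \<beta>) * f \<alpha>"
proof -
  let ?N = "\<lambda>noise. if noise then unif_market else return market_space \<alpha>"
  have "prob_space (return market_space \<alpha>)"
    using assms by (intro prob_space_return) (simp add: space_market_space)
  then have N: "?N \<in> measurable (measure_pmf (bernoulli_pmf \<beta>)) (subprob_algebra market_space)"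
    using prob_space_unif_market
    by (auto simp: space_subprob_algebra prob_space_imp_subprob_space sets_unif_market)
  have sets: "sets (mechanism \<beta> \<alpha>) = sets market_space"
    unfolding mechanism_def by (subst sets_bind[where N=market_space]) (auto simp: sets_unif_market)
  then have space: "space (mechanism \<beta> \<alpha>) = {0..1}"
    by (metis sets_eq_imp_space_eq space_market_space)
  have fu: "f \<in> borel_measurable unif_market"
    using f by (simp cong: measurable_cong_sets add: sets_unif_market)
  have fm: "f \<in> borel_measurable (mechanism \<beta> \<alpha>)"
    using f by (simp cong: measurable_cong_sets add: sets)
  have spu: "space unif_market = {0..1}"
    by (metis sets_eq_imp_space_eq space_market_space sets_unif_market)
  interpret U: prob_space unif_market by (rule prob_space_unif_market)
  have int: "integrable unif_market f"
    by (rule U.integrable_const_bound[where B=K]) (use bounds spu fu in \<open>auto intro!: AE_I2\<close>)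
  then have nn: "(\<integral>\<^sup>+x. ennreal (f x) \<partial>unif_market) = ennreal (integral\<^sup>L unif_market f)"
    by (rule nn_integral_eq_integral) (use bounds spu in \<open>auto intro!: AE_I2\<close>)
  have nonneg: "0 \<le> integral\<^sup>L unif_market f"
    by (rule Bochner_Integration.integral_nonneg) (use bounds spu in auto)
  have "(\<integral>\<^sup>+x. ennreal (f x) \<partial>mechanism \<beta> \<alpha>)
      = (\<integral>\<^sup>+noise. (\<integral>\<^sup>+x. ennreal (f x) \<partial>?N noise) \<partial>measure_pmf (bernoulli_pmf \<beta>))"
    unfolding mechanism_def by (rule nn_integral_bind[OF _ N]) (use f in measurable)
  also have "\<dots> = ennreal (integral\<^sup>L unif_market f) * \<beta> + ennreal (f \<alpha>) * (1 - \<beta>)"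
    using assms by (simp add: nn nn_integral_return space_market_space)
  also have "\<dots> = ennreal (\<beta> * integral\<^sup>L unif_market f + (1 - \<beta>) * f \<alpha>)"
    using assms(3,4) nonneg bounds[of \<alpha>] by (simp add: ennreal_plus ennreal_mult mult.commute)
  finally have *: "(\<integral>\<^sup>+x. ennreal (f x) \<partial>mechanism \<beta> \<alpha>)
      = ennreal (\<beta> * integral\<^sup>L unif_market f + (1 - \<beta>) * f \<alpha>)" .
  have "integral\<^sup>L (mechanism \<beta> \<alpha>) f = enn2real (\<integral>\<^sup>+x. ennreal (f x) \<partial>mechanism \<beta> \<alpha>)"
    by (rule integral_eq_nn_integral[OF fm], rule AE_I2) (simp add: bounds space)
  then show ?thesis
    unfolding * using assms(3,4) nonneg bounds[of \<alpha>] by (simp del: ennreal_plus)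
qed

lemma integral_unif_market_id: "(LINT x|unif_market. x) = 1 / 2"
proof -
  have "(LINT x|unif_market. x) = (LINT x|lborel. x ^ 1 * indicator {0..1} x)"
    by (simp add: unif_market_eq integral_restrict_space mult.commute)
  also have "\<dots> = 1 / 2"
    by (subst integral_power) auto
  finally show ?thesis .
qed

text \<open>Pricing rules come with no measurability assumption. Optimality fixes them on both sides
  of the threshold, so the integrands that they produce are step functions up to the value at one
  point.\<close>

lemma measurable_step:
  fixes f :: "real \<Rightarrow> real"
  assumes "\<And>x. x \<in> {0..1} \<Longrightarrow> x < t \<Longrightarrow> f x = a"
    and "\<And>x. x \<in> {0..1} \<Longrightarrow> x > t \<Longrightarrow> f x = b"
  shows "f \<in> borel_measurable market_space"
proof -
  have "(\<lambda>x. if x < t then a else if x = t then f t else b) \<in> borel_measurable market_space"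
    unfolding market_space_def by (rule measurable_restrict_space1) measurable
  then show ?thesis
    by (subst measurable_cong[of _ _ "\<lambda>x. if x < t then a else if x = t then f t else b"])
      (use assms in \<open>auto simp: space_market_space\<close>)
qed

lemma integral_unif_market_step:
  fixes f :: "real \<Rightarrow> real"
  assumes t: "t \<in> {0..1}"
    and f: "\<And>x. x \<in> {0..1} \<Longrightarrow> x < t \<Longrightarrow> f x = a" "\<And>x. x \<in> {0..1} \<Longrightarrow> x > t \<Longrightarrow> f x = b"
  shows "integral\<^sup>L unif_market f = t * a + (1 - t) * b"
proof -
  have [measurable]: "(\<lambda>x. indicator {0..1} x * f x) \<in> borel_measurable borel"
    using measurable_step[of t f a b, OF f]
    by (simp add: market_space_def borel_measurable_restrict_space_iff)
  \<comment> \<open>The two closed intervals overlap only in \<open>t\<close>, where the value of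
    \<open>f\<close> is arbitrary; this single point is a null set.\<close>
  have ae: "AE x in lborel. indicator {0..1} x * f x = a * indicator {0..t} x + b * indicator {t..1} x"
    using AE_lborel_singleton[of t]
  proof eventually_elim
    case (elim x)
    then show ?case
      using t f[of x] by (cases "x < t") (auto simp: indicator_def)
  qed
  have "integral\<^sup>L unif_market f = (LINT x|lborel. indicator {0..1} x * f x)"
    by (simp add: unif_market_eq integral_restrict_space)
  also have "\<dots> = (LINT x|lborel. a * indicator {0..t} x + b * indicator {t..1} x)"
    by (rule integral_cong_AE) (use ae in auto)
  also have "\<dots> = t * a + (1 - t) * b"
    using t by (subst Bochner_Integration.integral_add) auto
  finally show ?thesis .
qed

section \<open>Utilities and optimal prices\<close>

lemma pmf_market:
  assumes "\<alpha> \<in> {0..1}" "v1 < v2"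
  shows "pmf (market v1 v2 \<alpha>) v1 = 1 - \<alpha>" "pmf (market v1 v2 \<alpha>) v2 = \<alpha>"
proof -
  have eq: "market v1 v2 \<alpha> = map_pmf (\<lambda>b. if b then v2 else v1) (bernoulli_pmf \<alpha>)"
    by (simp add: market_def)
  have inj: "inj (\<lambda>b. if b then v2 else v1)"
    using assms(2) by (auto simp: inj_def split: if_splits)
  show "pmf (market v1 v2 \<alpha>) v1 = 1 - \<alpha>" "pmf (market v1 v2 \<alpha>) v2 = \<alpha>"
    using pmf_map_inj'[OF inj, of "bernoulli_pmf \<alpha>" False] pmf_map_inj'[OF inj, of "bernoulli_pmf \<alpha>" True]
      assms(1) by (simp_all add: eq)
qed

lemma producer_utility_market:
  assumes "\<alpha> \<in> {0..1}" "v1 < v2"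
  shows "producer_utility v1 v2 p (market v1 v2 \<alpha>) =
    (if p \<le> v1 then p else if p \<le> v2 then p * \<alpha> else 0)"
  using assms by (simp add: producer_utility_def pmf_market)

lemma consumer_utility_market:
  assumes "\<alpha> \<in> {0..1}" "v1 < v2"
  shows "consumer_utility v1 v2 v1 (market v1 v2 \<alpha>) = \<alpha> * (v2 - v1)"
    and "consumer_utility v1 v2 v2 (market v1 v2 \<alpha>) = 0"
  using assms by (simp_all add: consumer_utility_def pmf_market)

text \<open>Revenue is affine in the market, so only the posterior mean of \<alpha> matters; the
  uniform part contributes its mean 1/2.\<close>

lemma posterior_producer_utility_eq:
  assumes "\<alpha>h \<in> {0..1}" "\<beta> \<in> {0..1}" "v1 < v2" "0 \<le> p"
  shows "posterior_producer_utility v1 v2 \<beta> p \<alpha>h =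
    (if p \<le> v1 then p else if p \<le> v2 then p * (\<beta> / 2 + (1 - \<beta>) * \<alpha>h) else 0)"
proof -
  let ?f = "\<lambda>\<alpha>. producer_utility v1 v2 p (market v1 v2 \<alpha>)"
  let ?g = "\<lambda>\<alpha>. if p \<le> v1 then p else if p \<le> v2 then p * \<alpha> else 0"
  have fg: "?f x = ?g x" if "x \<in> {0..1}" for x
    using that assms by (simp add: producer_utility_market)
  have "?g \<in> borel_measurable market_space"
    unfolding market_space_def by (rule measurable_restrict_space1) measurable
  then have meas: "?f \<in> borel_measurable market_space"
    using fg by (subst measurable_cong[of _ _ ?g]) (auto simp: space_market_space)
  have "integral\<^sup>L unif_market ?f = integral\<^sup>L unif_market ?g"
    by (rule Bochner_Integration.integral_cong)
      (use fg in \<open>auto simp: unif_market_eq space_restrict_space\<close>)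
  also have "\<dots> = (if p \<le> v1 then p else if p \<le> v2 then p / 2 else 0)"
    using prob_space.prob_space[OF prob_space_unif_market] by (simp add: integral_unif_market_id)
  finally have "integral\<^sup>L unif_market ?f = (if p \<le> v1 then p else if p \<le> v2 then p / 2 else 0)" .
  moreover have "posterior_producer_utility v1 v2 \<beta> p \<alpha>h = integral\<^sup>L (mechanism \<beta> \<alpha>h) ?f"
    by (simp add: posterior_producer_utility_def posterior_def mechanism_def)
  moreover have "\<dots> = \<beta> * integral\<^sup>L unif_market ?f + (1 - \<beta>) * ?f \<alpha>h"
    by (rule integral_mechanism[where K=p])
      (use meas assms in \<open>auto simp: producer_utility_market mult_left_le\<close>)
  ultimately show ?thesis
    using fg[OF assms(1)] by (cases "p \<le> v1"; cases "p \<le> v2") (simp_all add: algebra_simps)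
qed

text \<open>Revenue is nondecreasing in the price up to \<open>v1\<close>, and again between
  \<open>v1\<close> and \<open>v2\<close>, so only \<open>v1\<close> and \<open>v2\<close> compete.
  Their revenues are \<open>v1\<close> and \<open>v2\<close> times the posterior mean
  \<open>s\<close>, and \<open>t\<close> is the report at which these agree.\<close>

lemma optimal_price_iff:
  assumes "0 < v1" "v1 < v2" "\<alpha>h \<in> {0..1}" "\<beta> \<in> {0..1}" "\<beta> \<noteq> 1"
    and t: "t = (v1 / v2 - \<beta> / 2) / (1 - \<beta>)"
  shows "optimal_price v1 v2 \<beta> \<alpha>h v1 \<longleftrightarrow> \<alpha>h \<le> t"
    and "optimal_price v1 v2 \<beta> \<alpha>h v2 \<longleftrightarrow> t \<le> \<alpha>h"
proof -
  define s where "s = \<beta> / 2 + (1 - \<beta>) * \<alpha>h"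
  have s0: "0 \<le> s"
    using assms by (simp add: s_def)
  have cross: "\<alpha>h \<le> t \<longleftrightarrow> v2 * s \<le> v1" "t \<le> \<alpha>h \<longleftrightarrow> v1 \<le> v2 * s"
    using assms by (auto simp: t s_def field_simps)
  have u: "posterior_producer_utility v1 v2 \<beta> p \<alpha>h =
      (if p \<le> v1 then p else if p \<le> v2 then p * s else 0)" if "0 \<le> p" for p
    using posterior_producer_utility_eq assms that by (simp add: s_def)
  have max: "posterior_producer_utility v1 v2 \<beta> p \<alpha>h \<le> max v1 (v2 * s)" if "0 \<le> p" for p
    using that s0 assms mult_right_mono[of p v2 s] by (auto simp: u max_def)
  have v1: "posterior_producer_utility v1 v2 \<beta> v1 \<alpha>h = v1"
    and v2: "posterior_producer_utility v1 v2 \<beta> v2 \<alpha>h = v2 * s"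
    using assms by (auto simp: u)
  show "optimal_price v1 v2 \<beta> \<alpha>h v1 \<longleftrightarrow> \<alpha>h \<le> t"
    unfolding optimal_price_def v1 cross
  proof safe
    assume "\<forall>p'\<ge>0. posterior_producer_utility v1 v2 \<beta> p' \<alpha>h \<le> v1"
    from this[rule_format, of v2] show "v2 * s \<le> v1" using v2 assms by simp
  qed (use assms max in \<open>fastforce+\<close>)
  show "optimal_price v1 v2 \<beta> \<alpha>h v2 \<longleftrightarrow> t \<le> \<alpha>h"
    unfolding optimal_price_def v2 cross
  proof safe
    assume "\<forall>p'\<ge>0. posterior_producer_utility v1 v2 \<beta> p' \<alpha>h \<le> v2 * s"
    from this[rule_format, of v1] show "v1 \<le> v2 * s" using v1 assms by simp
  qed (use assms max in \<open>fastforce+\<close>)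
qed

section \<open>Pricing rules as threshold rules\<close>

text \<open>Here \<open>r \<alpha>\<close> stands for the probability of the low price after report
  \<alpha>; at \<alpha> = \<open>t\<close> it may be any number in the unit interval.\<close>

definition threshold_rule :: "real \<Rightarrow> (real \<Rightarrow> real) \<Rightarrow> bool" where
  "threshold_rule t r \<longleftrightarrow>
    (\<forall>\<alpha>\<in>{0..1}. 0 \<le> r \<alpha> \<and> r \<alpha> \<le> 1 \<and> (\<alpha> < t \<longrightarrow> r \<alpha> = 1) \<and> (\<alpha> > t \<longrightarrow> r \<alpha> = 0))"

lemma expectation_two_prices:
  fixes g :: "real \<Rightarrow> real"
  assumes "set_pmf P \<subseteq> {v1, v2}" "v1 \<noteq> v2"
  shows "measure_pmf.expectation P g = pmf P v1 * g v1 + (1 - pmf P v1) * g v2"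
proof -
  have "sum (pmf P) {v1, v2} = 1"
    by (rule sum_pmf_eq_1) (use assms in auto)
  then have "pmf P v2 = 1 - pmf P v1"
    using assms by simp
  moreover have "measure_pmf.expectation P g = (\<Sum>v\<in>{v1, v2}. pmf P v * g v)"
    using assms by (subst integral_measure_pmf[of "{v1, v2}"]) auto
  ultimately show ?thesis
    using assms by simp
qed

lemma threshold_rule_of_pricing_rule:
  assumes "0 < v1" "v1 < v2" "\<beta> \<in> {0..1}" "\<beta> \<noteq> 1" "t = (v1 / v2 - \<beta> / 2) / (1 - \<beta>)"
    and opt: "optimal_pricing_rule v1 v2 \<beta> \<phi>"
  shows "threshold_rule t (\<lambda>\<alpha>. pmf (\<phi> \<alpha>) v1)"
  unfolding threshold_rule_def
proof (intro ballI conjI impI)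
  fix \<alpha> :: real assume \<alpha>: "\<alpha> \<in> {0..1}"
  note iff = optimal_price_iff[OF assms(1,2) \<alpha> assms(3-5)]
  have S: "set_pmf (\<phi> \<alpha>) \<subseteq> {v1, v2}" "\<And>p. p \<in> set_pmf (\<phi> \<alpha>) \<Longrightarrow> optimal_price v1 v2 \<beta> \<alpha> p"
    using opt \<alpha> by (auto simp: optimal_pricing_rule_def)
  show "pmf (\<phi> \<alpha>) v1 = 1" if "\<alpha> < t"
  proof -
    have "set_pmf (\<phi> \<alpha>) \<subseteq> {v1}"
      using S iff that by force
    then show ?thesis
      using sum_pmf_eq_1[of "{v1}" "\<phi> \<alpha>"] by simp
  qed
  show "pmf (\<phi> \<alpha>) v1 = 0" if "\<alpha> > t"
    using S(2)[of v1] iff that by (force simp: set_pmf_iff)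
qed (simp_all add: pmf_le_1)

lemma pricing_rule_of_threshold_rule:
  assumes "0 < v1" "v1 < v2" "\<beta> \<in> {0..1}" "\<beta> \<noteq> 1" "t = (v1 / v2 - \<beta> / 2) / (1 - \<beta>)"
    and r: "threshold_rule t r"
  obtains \<phi> where "optimal_pricing_rule v1 v2 \<beta> \<phi>" "\<And>\<alpha>. \<alpha> \<in> {0..1} \<Longrightarrow> pmf (\<phi> \<alpha>) v1 = r \<alpha>"
proof
  \<comment> \<open>\<^const>\<open>market\<close> is just a two-point distribution; here it carries the price lottery.\<close>
  define \<phi> where "\<phi> \<alpha> = market v1 v2 (1 - r \<alpha>)" for \<alpha>
  have r01: "1 - r \<alpha> \<in> {0..1}" if "\<alpha> \<in> {0..1}" for \<alpha>
    using r that by (auto simp: threshold_rule_def)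
  show pmf1: "pmf (\<phi> \<alpha>) v1 = r \<alpha>" if "\<alpha> \<in> {0..1}" for \<alpha>
    using pmf_market[OF r01[OF that] assms(2)] by (simp add: \<phi>_def)
  have pmf2: "pmf (\<phi> \<alpha>) v2 = 1 - r \<alpha>" if "\<alpha> \<in> {0..1}" for \<alpha>
    using pmf_market[OF r01[OF that] assms(2)] by (simp add: \<phi>_def)
  show "optimal_pricing_rule v1 v2 \<beta> \<phi>"
    unfolding optimal_pricing_rule_def
  proof (intro ballI conjI)
    fix \<alpha> :: real assume \<alpha>: "\<alpha> \<in> {0..1}"
    show sub: "set_pmf (\<phi> \<alpha>) \<subseteq> {v1, v2}"
      by (auto simp: \<phi>_def market_def)
    fix p assume p: "p \<in> set_pmf (\<phi> \<alpha>)"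
    \<comment> \<open>A price in the support has positive weight:
      \<open>r \<alpha> \<noteq> 0\<close> excludes \<alpha> > \<open>t\<close>, and
      \<open>r \<alpha> \<noteq> 1\<close> excludes \<alpha> < \<open>t\<close>, which is what
      optimality of the respective price demands.\<close>
    then have "p = v1 \<and> r \<alpha> \<noteq> 0 \<or> p = v2 \<and> 1 - r \<alpha> \<noteq> 0"
      using sub pmf1[OF \<alpha>] pmf2[OF \<alpha>] by (auto simp: set_pmf_iff)
    then show "optimal_price v1 v2 \<beta> \<alpha> p"
      using optimal_price_iff[OF assms(1,2) \<alpha> assms(3-5)] r \<alpha>
      by (force simp: threshold_rule_def)
  qed
qed

text \<open>Under noise the low price is charged with probability \<open>t\<close>, the length of
  the interval of reports below the threshold, whatever the tie-breaking. Only the truthful part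
  sees the rule at \<alpha> itself.\<close>

lemma integral_mechanism_two_prices:
  fixes g :: "real \<Rightarrow> real"
  assumes "v1 < v2" "\<beta> \<in> {0..1}" "\<alpha> \<in> {0..1}" "t \<in> {0..1}"
    and sub: "\<And>\<alpha>. \<alpha> \<in> {0..1} \<Longrightarrow> set_pmf (\<phi> \<alpha>) \<subseteq> {v1, v2}"
    and r: "threshold_rule t (\<lambda>\<alpha>. pmf (\<phi> \<alpha>) v1)"
    and g: "0 \<le> g v1" "0 \<le> g v2"
  shows "(LINT \<alpha>h|mechanism \<beta> \<alpha>. measure_pmf.expectation (\<phi> \<alpha>h) g) =
    \<beta> * (t * g v1 + (1 - t) * g v2) +
    (1 - \<beta>) * (pmf (\<phi> \<alpha>) v1 * g v1 + (1 - pmf (\<phi> \<alpha>) v1) * g v2)"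
proof -
  let ?f = "\<lambda>\<alpha>h. measure_pmf.expectation (\<phi> \<alpha>h) g"
  have f: "?f x = pmf (\<phi> x) v1 * g v1 + (1 - pmf (\<phi> x) v1) * g v2" if "x \<in> {0..1}" for x
    using sub[OF that] assms(1) by (intro expectation_two_prices) auto
  have step: "\<And>x. x \<in> {0..1} \<Longrightarrow> x < t \<Longrightarrow> ?f x = g v1" "\<And>x. x \<in> {0..1} \<Longrightarrow> x > t \<Longrightarrow> ?f x = g v2"
    using r f by (auto simp: threshold_rule_def)
  have "0 \<le> ?f x \<and> ?f x \<le> g v1 + g v2" if "x \<in> {0..1}" for x
    unfolding f[OF that]
    using g by (intro conjI add_nonneg_nonneg add_mono mult_nonneg_nonneg mult_left_le_one_le)
      (auto simp: pmf_le_1)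
  then have "integral\<^sup>L (mechanism \<beta> \<alpha>) ?f = \<beta> * integral\<^sup>L unif_market ?f + (1 - \<beta>) * ?f \<alpha>"
    using measurable_step[of t ?f, OF step] assms(2,3) by (intro integral_mechanism) auto
  also have "integral\<^sup>L unif_market ?f = t * g v1 + (1 - t) * g v2"
    using step by (rule integral_unif_market_step[OF assms(4)])
  finally show ?thesis
    unfolding f[OF assms(3)] .
qed

section \<open>The region of low-price probabilities and its vertices\<close>

text \<open>
  The coordinates of \<open>payoff_region\<close> are \<open>(w, m)\<close>, where \<open>m\<close> is the probability that a truthfully
  reported segment is charged the low price, and \<open>w\<close> the probability that in addition the buyer has
  the high value. Optimality forces \<open>\<alpha> \<le> t\<close> wherever the low price is charged and \<open>\<alpha> \<ge> t\<close> wherever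
  the high price is, which gives the inequalities with slope \<open>t\<close>.
\<close>

definition payoff_region :: "real \<Rightarrow> real \<Rightarrow> (real \<times> real) set" where
  "payoff_region t a = {(w, m). 0 \<le> m \<and> m \<le> 1 \<and> 0 \<le> w \<and> w \<le> t * m \<and>
    t * (1 - m) \<le> a - w \<and> a - w \<le> 1 - m}"

lemma convex_payoff_region: "convex (payoff_region t a)"
proof -
  have "payoff_region t a =
      {z. (0, -1) \<bullet> z \<le> 0} \<inter> {z. (0, 1) \<bullet> z \<le> 1} \<inter>
      {z. (-1, 0) \<bullet> z \<le> 0} \<inter> {z. (1, - t) \<bullet> z \<le> 0} \<inter>
      {z. (1, - t) \<bullet> z \<le> a - t} \<inter> {z. (-1, 1) \<bullet> z \<le> 1 - a}"
    by (auto simp: payoff_region_def algebra_simps)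
  then show ?thesis
    by (simp add: convex_Int convex_halfspace_le)
qed

text \<open>For \<open>0 < t < 1\<close> the region is cut out by \<open>w \<ge> 0\<close>,
  \<open>m - w \<le> 1 - a\<close> and the stronger of the two parallel constraints
  \<open>w - t * m \<le> 0\<close> and \<open>w - t * m \<le> a - t\<close>; hence the case split on
  \<open>a < t\<close>. The vertices are the pairwise intersections of the boundary lines. For
  \<open>t = 0\<close> or \<open>t = 1\<close> the region is a segment or a point, and the quotient
  with zero denominator has numerator zero too, so its value 0 gives the right vertex.\<close>

lemma payoff_region_eq_hull:
  fixes t a :: real
  assumes t: "t \<in> {0..1}" and a: "a \<in> {0..1}"
    and X: "X = max (a - t) 0 / (1 - t)" and Y: "Y = max (t - a) 0 / t"
  shows "payoff_region t a = convex hull {(0, Y), (0, 1 - a), (a - X, 1 - X)}"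
proof
  have "(0, Y) \<in> payoff_region t a"
  proof (cases "a < t")
    case True
    then have "Y = 1 - a / t" "a / t \<le> 1" "a \<le> a / t"
      using t a by (auto simp: Y field_simps mult_left_le)
    then show ?thesis
      using True t a by (auto simp: payoff_region_def)
  qed (use t a in \<open>auto simp: payoff_region_def Y\<close>)
  moreover have "(0, 1 - a) \<in> payoff_region t a"
    using t a by (auto simp: payoff_region_def mult_left_le_one_le)
  moreover have "(a - X, 1 - X) \<in> payoff_region t a"
  proof (cases "t < a")
    case True
    then have "t < 1" using a by auto
    then have X': "X = (a - t) / (1 - t)" "0 \<le> X" "X \<le> 1" "a - X = t * (1 - X)"
      using True a by (auto simp: X divide_le_eq_1) (simp add: field_simps)
    have "t * X \<le> X" "0 \<le> t * (1 - X)"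
      using t X'(2,3) by (simp_all only: mult_left_le_one_le mult_nonneg_nonneg diff_ge_0_iff_ge atLeastAtMost_iff)
    then show ?thesis
      using X' by (simp add: payoff_region_def)
  qed (use t a in \<open>auto simp: payoff_region_def X\<close>)
  ultimately show "convex hull {(0, Y), (0, 1 - a), (a - X, 1 - X)} \<subseteq> payoff_region t a"
    by (intro hull_minimal convex_payoff_region) auto
next
  show "payoff_region t a \<subseteq> convex hull {(0, Y), (0, 1 - a), (a - X, 1 - X)}"
  proof
    fix z assume "z \<in> payoff_region t a"
    then obtain w m where z: "z = (w, m)"
      and R: "0 \<le> m" "m \<le> 1" "0 \<le> w" "w \<le> t * m" "t * (1 - m) \<le> a - w" "a - w \<le> 1 - m"
      by (auto simp: payoff_region_def)
    have "\<exists>x y z'. 0 \<le> x \<and> 0 \<le> y \<and> 0 \<le> z' \<and> x + y + z' = 1 \<and>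
        w = z' * (a - X) \<and> m = x * Y + y * (1 - a) + z' * (1 - X)"
    proof (cases "a < t")
      case True
      then have XY: "X = 0" "Y = 1 - a / t" and "t > 0"
        using a by (auto simp: X Y field_simps)
      \<comment> \<open>The vertices are now \<open>(0, 1 - a / t)\<close>,
        \<open>(0, 1 - a)\<close> and \<open>(a, 1)\<close>. They all coincide for
        \<open>a = 0\<close>, and the first two coincide for \<open>t = 1\<close>; otherwise the
        triangle is proper.\<close>
      consider "a = 0" | "a > 0" "t = 1" | "a > 0" "t < 1"
        using a t by fastforce
      then show ?thesis
      proof cases
        case 1
        then have "t * (1 - m) \<le> 0" using R by linarith
        then have "m = 1" using \<open>t > 0\<close> R(2) by (simp add: mult_le_0_iff)
        then show ?thesis
          using 1 R XY by (intro exI[of _ 0] exI[of _ 0] exI[of _ 1]) auto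
      next
        case 2
        then have "w \<le> a" "m = 1 - a + w"
          using R by auto
        moreover have "1 - a + w = (1 - w / a) * (1 - a) + w / a"
          using 2 by (simp add: field_simps)
        ultimately show ?thesis
          using 2 R XY by (intro exI[of _ "1 - w / a"] exI[of _ 0] exI[of _ "w / a"]) auto
      next
        case 3
        \<comment> \<open>Barycentric coordinates: the third weight is \<open>w / a\<close>, as the
          other two vertices lie on \<open>w = 0\<close>. Each remaining weight is the normalised
          slack in the inequality whose line carries the opposite edge.\<close>
        have x: "0 \<le> t * (1 - a - m + w) / (a * (1 - t))"
          using 3 t R by (intro divide_nonneg_nonneg mult_nonneg_nonneg) auto
        have y: "0 \<le> (a - w - t * (1 - m)) / (a * (1 - t))"
          using 3 t R by (intro divide_nonneg_nonneg mult_nonneg_nonneg) auto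
        have sum: "t * (1 - a - m + w) / (a * (1 - t)) + (a - w - t * (1 - m)) / (a * (1 - t)) + w / a = 1"
          using 3 by (simp add: divide_simps) (simp add: algebra_simps)
        have m: "t * (1 - a - m + w) / (a * (1 - t)) * (1 - a / t)
            + (a - w - t * (1 - m)) / (a * (1 - t)) * (1 - a) + w / a = m"
          using 3 \<open>t > 0\<close> by (simp add: divide_simps) (simp add: algebra_simps)
        show ?thesis
          using x y sum m 3 R XY
          by (intro exI[of _ "t * (1 - a - m + w) / (a * (1 - t))"]
              exI[of _ "(a - w - t * (1 - m)) / (a * (1 - t))"] exI[of _ "w / a"]) auto
      qed
    next
      case False
      then have Y0: "Y = 0"
        by (simp add: Y)
      \<comment> \<open>The first vertex is now the origin. The first three cases are degenerate:
        for \<open>t = 1\<close> also \<open>a = 1\<close> and the first two vertices coincide, for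
        \<open>a = 1\<close> with \<open>t < 1\<close> all three do, and for \<open>t = 0\<close>
        the last two do.\<close>
      consider "t = 1" | "t < 1" "a = 1" | "t = 0" "a < 1" | "0 < t" "t < 1" "a < 1"
        using a t by fastforce
      then show ?thesis
      proof cases
        case 1
        then show ?thesis
          using R False Y0 a by (intro exI[of _ "1 - w"] exI[of _ 0] exI[of _ w]) (auto simp: X)
      next
        case 2
        then have "(1 - t) * m \<le> 0" using R by (simp add: algebra_simps)
        then have "m = 0" using 2 R by (simp add: mult_le_0_iff)
        then show ?thesis
          using R 2 Y0 by (intro exI[of _ 1] exI[of _ 0] exI[of _ 0]) auto
      next
        case 3
        then have "w = 0" "m / (1 - a) \<le> 1"
          using R by (auto simp: divide_le_eq_1)
        then show ?thesis
          using 3 R Y0 by (intro exI[of _ "1 - m / (1 - a)"] exI[of _ "m / (1 - a)"] exI[of _ 0]) auto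
      next
        case 4
        have X': "a - X = t * (1 - a) / (1 - t)" "1 - X = (1 - a) / (1 - t)"
          using False 4 by (auto simp: X field_simps)
        \<comment> \<open>\<open>d\<close> is the weight of the third vertex, read off from the
          coordinate \<open>w\<close>; that vertex then contributes \<open>w / t\<close> to
          \<open>m\<close>, and \<open>b\<close>, the weight of \<open>(0, 1 - a)\<close>, supplies
          the rest. The origin takes the remaining weight.\<close>
        define b where "b = (m - w / t) / (1 - a)"
        define d where "d = w * (1 - t) / (t * (1 - a))"
        have "0 \<le> b" "0 \<le> d"
          using 4 R by (auto simp: b_def d_def divide_le_eq mult.commute)
        have b: "b * (1 - a) = m - w / t" and d: "d * (1 - a) = w / t - w"
          using 4 by (auto simp: b_def d_def field_simps)
        \<comment> \<open>The left side equals \<open>m - w\<close>, so this is the constraint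
          \<open>a - w \<le> 1 - m\<close>.\<close>
        have "(b + d) * (1 - a) \<le> 1 * (1 - a)"
          using R unfolding distrib_right b d by simp
        then have "b + d \<le> 1"
          using 4 by (simp only: mult_le_cancel_right_pos diff_gt_0_iff_gt)
        moreover have "d * (t * (1 - a) / (1 - t)) = w" "d * ((1 - a) / (1 - t)) = w / t"
          using 4 by (auto simp: d_def)
        ultimately show ?thesis
          unfolding X' Y0 using \<open>0 \<le> b\<close> \<open>0 \<le> d\<close> b
          by (intro exI[of _ "1 - (b + d)"] exI[of _ b] exI[of _ d]) auto
      qed
    qed
    then show "z \<in> convex hull {(0, Y), (0, 1 - a), (a - X, 1 - X)}"
      unfolding convex_hull_3 z by fastforce
  qed
qed

text \<open>Segment the low-priced and the high-priced buyers separately. The low-priced mass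
  \<open>m\<close> with high-value mass \<open>w\<close> splits into \<open>w / t\<close> at the tie
  and the rest at 0; the high-priced mass \<open>1 - m\<close> with high-value mass
  \<open>a - w\<close> splits into \<open>l\<close> at the tie and the rest at 1. The two parts at
  \<open>t\<close> merge into one atom, and randomised tie-breaking recovers their
  proportions.\<close>

lemma payoff_region_attained:
  assumes t: "t \<in> {0..1}" and a: "a \<in> {0..1}" and R: "(w, m) \<in> payoff_region t a"
  obtains p0 pt p1 r where "0 \<le> p0" "0 \<le> pt" "0 \<le> p1" "p0 + pt + p1 = 1" "pt * t + p1 = a"
    "threshold_rule t r" "p0 * r 0 + pt * r t + p1 * r 1 = m" "pt * r t * t + p1 * r 1 = w"
proof -
  note R = R[unfolded payoff_region_def, simplified]
  \<comment> \<open>For \<open>s = 0\<close> also \<open>u = 0\<close>, and the witness is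
    \<open>u / 0 = 0\<close>.\<close>
  have split: "\<exists>\<rho>. 0 \<le> \<rho> \<and> \<rho> \<le> 1 \<and> s * \<rho> = u" if "0 \<le> u" "u \<le> s" for s u :: real
    using that by (intro exI[of _ "u / s"]) (auto simp: divide_le_eq_1)
  consider "t = 0" | "t = 1" | "0 < t" "t < 1"
    using t by fastforce
  then show thesis
  proof cases
    \<comment> \<open>At \<open>t = 0\<close>, and likewise at \<open>t = 1\<close> below, the tie
      is itself an end atom: the middle atom gets mass 0 and that end atom carries the
      tie-breaking.\<close>
    case 1
    then have w: "w = 0" "m \<le> 1 - a" using R by auto
    obtain \<rho> where \<rho>: "0 \<le> \<rho>" "\<rho> \<le> 1" "(1 - a) * \<rho> = m"
      using split[of m "1 - a"] w R by auto
    show thesis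
      by (rule that[of "1 - a" 0 a "\<lambda>x. if x < t then 1 else if x = t then \<rho> else 0"])
        (use 1 w \<rho> a in \<open>auto simp: threshold_rule_def\<close>)
  next
    case 2
    then have w: "w = a - 1 + m" "w \<le> a" using R by auto
    obtain \<rho> where \<rho>: "0 \<le> \<rho>" "\<rho> \<le> 1" "a * \<rho> = w"
      using split[of w a] w R by auto
    show thesis
      by (rule that[of "1 - a" 0 a "\<lambda>x. if x < t then 1 else if x = t then \<rho> else 0"])
        (use 2 w \<rho> a in \<open>auto simp: threshold_rule_def\<close>)
  next
    case 3
    \<comment> \<open>\<open>l\<close> solves \<open>l * t + (1 - m - l) = a - w\<close>, the mean
      condition for the high-priced part.\<close>
    define l where "l = (1 - m - (a - w)) / (1 - t)"
    have l: "0 \<le> l" "l * (1 - t) = 1 - m - (a - w)"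
      using 3 R by (auto simp: l_def)
    have "l * (1 - t) \<le> (1 - m) * (1 - t)"
      unfolding l using R by (simp add: algebra_simps)
    then have l1: "l \<le> 1 - m" using 3 by simp
    have wt: "0 \<le> w / t" "w / t \<le> m"
      using 3 R by (auto simp: divide_le_eq mult.commute)
    obtain \<rho> where \<rho>: "0 \<le> \<rho>" "\<rho> \<le> 1" "(w / t + l) * \<rho> = w / t"
      using split[of "w / t" "w / t + l"] l wt by auto
    have mean: "(w / t + l) * t + (1 - m - l) = a"
      using l(2) 3 by (simp add: algebra_simps)
    show thesis
      by (rule that[of "m - w / t" "w / t + l" "1 - m - l" "\<lambda>x. if x < t then 1 else if x = t then \<rho> else 0"])
        (use 3 l l1 wt \<rho> mean in \<open>auto simp: threshold_rule_def\<close>)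
  qed
qed

section \<open>Segmentations and the payoff region\<close>

text \<open>The formula survives \<open>t = 0\<close> and \<open>t = 1\<close> because
  \<open>pmf_of_list\<close> adds the weights of repeated points, and vanishing weights because
  points outside the support contribute zero.\<close>

lemma sum_pmf_of_list_three:
  fixes g :: "real \<Rightarrow> real"
  assumes p: "0 \<le> p0" "0 \<le> pt" "0 \<le> p1" "p0 + pt + p1 = 1"
  shows "(\<Sum>\<alpha>\<in>set_pmf (pmf_of_list [(0, p0), (t, pt), (1, p1)]).
      pmf (pmf_of_list [(0, p0), (t, pt), (1, p1)]) \<alpha> * g \<alpha>) = p0 * g 0 + pt * g t + p1 * g 1"
proof -
  let ?xs = "[(0, p0), (t, pt), (1, p1)] :: (real \<times> real) list"
  have wf: "pmf_of_list_wf ?xs"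
    using p by (auto simp: pmf_of_list_wf_def)
  have "set_pmf (pmf_of_list ?xs) \<subseteq> {0, t, 1}"
    using set_pmf_of_list[OF wf] by simp
  then have "(\<Sum>\<alpha>\<in>set_pmf (pmf_of_list ?xs). pmf (pmf_of_list ?xs) \<alpha> * g \<alpha>)
      = (\<Sum>\<alpha>\<in>{0, t, 1}. pmf (pmf_of_list ?xs) \<alpha> * g \<alpha>)"
    by (intro sum.mono_neutral_left) (auto simp: set_pmf_iff)
  also have "\<dots> = p0 * g 0 + pt * g t + p1 * g 1"
    using wf by (cases "t = 0"; cases "t = 1") (auto simp: pmf_pmf_of_list algebra_simps)
  finally show ?thesis .
qed

text \<open>As the weights sum to 1, the equations at \<open>v1\<close> and \<open>v2\<close> are
  complementary, and both fix the mean.\<close>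

lemma segmentations_iff:
  assumes "v1 < v2" "\<alpha>s \<in> {0..1}"
  shows "\<sigma> \<in> segmentations v1 v2 \<alpha>s \<longleftrightarrow> finite (set_pmf \<sigma>) \<and> set_pmf \<sigma> \<subseteq> {0..1} \<and>
    (\<Sum>\<alpha>\<in>set_pmf \<sigma>. pmf \<sigma> \<alpha> * \<alpha>) = \<alpha>s"
proof (cases "finite (set_pmf \<sigma>) \<and> set_pmf \<sigma> \<subseteq> {0..1}")
  case True
  have "(\<Sum>\<alpha>\<in>set_pmf \<sigma>. pmf \<sigma> \<alpha> * pmf (market v1 v2 \<alpha>) v2) = (\<Sum>\<alpha>\<in>set_pmf \<sigma>. pmf \<sigma> \<alpha> * \<alpha>)"
    by (rule sum.cong) (use True assms in \<open>auto simp: pmf_market subset_iff\<close>)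
  moreover have "(\<Sum>\<alpha>\<in>set_pmf \<sigma>. pmf \<sigma> \<alpha> * pmf (market v1 v2 \<alpha>) v1)
      = (\<Sum>\<alpha>\<in>set_pmf \<sigma>. pmf \<sigma> \<alpha> - pmf \<sigma> \<alpha> * \<alpha>)"
    by (rule sum.cong) (use True assms in \<open>auto simp: pmf_market subset_iff algebra_simps\<close>)
  ultimately show ?thesis
    using True assms sum_pmf_eq_1[of "set_pmf \<sigma>" \<sigma>]
    by (auto simp: segmentations_def pmf_market sum_subtractf)
qed (auto simp: segmentations_def)

text \<open>Each inequality of the region holds market by market and survives averaging over the
  segmentation; the converse uses the three-atom segmentations above.\<close>

lemma payoff_region_eq:
  assumes "v1 < v2" and t: "t \<in> {0..1}" and a: "\<alpha>s \<in> {0..1}"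
  shows "payoff_region t \<alpha>s =
    {(\<Sum>\<alpha>\<in>set_pmf \<sigma>. pmf \<sigma> \<alpha> * (r \<alpha> * \<alpha>), \<Sum>\<alpha>\<in>set_pmf \<sigma>. pmf \<sigma> \<alpha> * r \<alpha>) | \<sigma> r.
      \<sigma> \<in> segmentations v1 v2 \<alpha>s \<and> threshold_rule t r}" (is "_ = ?T")
proof
  show "?T \<subseteq> payoff_region t \<alpha>s"
  proof safe
    fix \<sigma> r
    assume "\<sigma> \<in> segmentations v1 v2 \<alpha>s" and r: "threshold_rule t r"
    then have fin: "finite (set_pmf \<sigma>)" and sub: "set_pmf \<sigma> \<subseteq> {0..1}"
      and mean: "(\<Sum>\<alpha>\<in>set_pmf \<sigma>. pmf \<sigma> \<alpha> * \<alpha>) = \<alpha>s"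
      using segmentations_iff[OF assms(1) a] by auto
    have total: "(\<Sum>\<alpha>\<in>set_pmf \<sigma>. pmf \<sigma> \<alpha>) = 1"
      using fin by (intro sum_pmf_eq_1) auto
    have rule: "0 \<le> r \<alpha>" "r \<alpha> \<le> 1" "r \<alpha> * \<alpha> \<le> t * r \<alpha>" "t * (1 - r \<alpha>) \<le> (1 - r \<alpha>) * \<alpha>"
      "0 \<le> \<alpha>" "\<alpha> \<le> 1" if "\<alpha> \<in> set_pmf \<sigma>" for \<alpha>
    proof -
      have \<alpha>: "\<alpha> \<in> {0..1}"
        using sub that by blast
      then show "0 \<le> r \<alpha>" "r \<alpha> \<le> 1" "0 \<le> \<alpha>" "\<alpha> \<le> 1"
        using r by (auto simp: threshold_rule_def)
      show "r \<alpha> * \<alpha> \<le> t * r \<alpha>" "t * (1 - r \<alpha>) \<le> (1 - r \<alpha>) * \<alpha>"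
        using r \<alpha> by (cases \<alpha> t rule: linorder_cases; auto simp: threshold_rule_def mult.commute)+
    qed
    let ?E = "\<lambda>g. \<Sum>\<alpha>\<in>set_pmf \<sigma>. pmf \<sigma> \<alpha> * (g \<alpha> :: real)"
    have mono: "?E g \<le> ?E h" if "\<And>\<alpha>. \<alpha> \<in> set_pmf \<sigma> \<Longrightarrow> g \<alpha> \<le> h \<alpha>" for g h
      by (intro sum_mono mult_left_mono that) auto
    have "0 \<le> ?E r" "?E r \<le> 1"
      using mono[of "\<lambda>_. 0" r] mono[of r "\<lambda>_. 1"] rule total by simp_all
    moreover have "0 \<le> ?E (\<lambda>\<alpha>. r \<alpha> * \<alpha>)"
      using mono[of "\<lambda>_. 0" "\<lambda>\<alpha>. r \<alpha> * \<alpha>"] rule by simp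
    moreover have "?E (\<lambda>\<alpha>. r \<alpha> * \<alpha>) \<le> ?E (\<lambda>\<alpha>. t * r \<alpha>)"
      by (rule mono) (rule rule)
    moreover have "?E (\<lambda>\<alpha>. t * (1 - r \<alpha>)) \<le> ?E (\<lambda>\<alpha>. (1 - r \<alpha>) * \<alpha>)"
      by (rule mono) (rule rule)
    moreover have "?E (\<lambda>\<alpha>. (1 - r \<alpha>) * \<alpha>) \<le> ?E (\<lambda>\<alpha>. 1 - r \<alpha>)"
      by (rule mono) (use rule in \<open>auto intro: mult_left_le\<close>)
    moreover have "?E (\<lambda>\<alpha>. t * r \<alpha>) = t * ?E r"
      by (simp add: sum_distrib_left mult.left_commute)
    moreover have "?E (\<lambda>\<alpha>. 1 - r \<alpha>) = 1 - ?E r"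
      by (simp add: right_diff_distrib sum_subtractf total)
    moreover have "?E (\<lambda>\<alpha>. t * (1 - r \<alpha>)) = t * ?E (\<lambda>\<alpha>. 1 - r \<alpha>)"
      by (simp add: sum_distrib_left mult.left_commute)
    moreover have "?E (\<lambda>\<alpha>. (1 - r \<alpha>) * \<alpha>) = \<alpha>s - ?E (\<lambda>\<alpha>. r \<alpha> * \<alpha>)"
      by (simp add: algebra_simps sum_subtractf flip: mean)
    ultimately show "(?E (\<lambda>\<alpha>. r \<alpha> * \<alpha>), ?E r) \<in> payoff_region t \<alpha>s"
      by (simp add: payoff_region_def)
  qed
next
  show "payoff_region t \<alpha>s \<subseteq> ?T"
  proof
    fix z assume z: "z \<in> payoff_region t \<alpha>s"
    obtain w m where zz: "z = (w, m)" by (cases z)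
    obtain p0 pt p1 r where p: "0 \<le> p0" "0 \<le> pt" "0 \<le> p1" "p0 + pt + p1 = 1" "pt * t + p1 = \<alpha>s"
      and r: "threshold_rule t r" "p0 * r 0 + pt * r t + p1 * r 1 = m" "pt * r t * t + p1 * r 1 = w"
      using payoff_region_attained[OF t a z[unfolded zz]] by blast
    define \<sigma> where "\<sigma> = pmf_of_list [(0, p0), (t, pt), (1, p1)]"
    have wf: "pmf_of_list_wf [(0, p0), (t, pt), (1, p1)]"
      using p by (auto simp: pmf_of_list_wf_def)
    note sums = sum_pmf_of_list_three[OF p(1-4), of t, folded \<sigma>_def]
    have "\<sigma> \<in> segmentations v1 v2 \<alpha>s"
      unfolding segmentations_iff[OF assms(1) a]
      using set_pmf_of_list[OF wf] finite_set_pmf_of_list[OF wf] t p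
      by (auto simp: sums \<sigma>_def[symmetric])
    then show "z \<in> ?T"
      using r zz sums[of r] sums[of "\<lambda>\<alpha>. r \<alpha> * \<alpha>"] by (auto intro!: exI[of _ \<sigma>] exI[of _ r])
  qed
qed

section \<open>The achievable set as an affine image of the region\<close>

text \<open>The first summand of \<open>F\<close> is the contribution of noise. In the truthful part
  a high-value buyer at the low price gains \<open>v2 - v1\<close>, the producer earns
  \<open>v1\<close> on the mass \<open>m\<close> and \<open>v2\<close> on the high-value mass
  \<open>\<alpha>s - w\<close> that faces the high price.\<close>

lemma achievable_eq_image:
  fixes v1 v2 \<beta> \<alpha>s t :: real
  defines "F \<equiv> \<lambda>(w, m).
    \<beta> *\<^sub>R (t * \<alpha>s * (v2 - v1), t * v1 + (1 - t) * \<alpha>s * v2) +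
    (1 - \<beta>) *\<^sub>R (w * (v2 - v1), m * v1 + (\<alpha>s - w) * v2)"
  assumes v: "0 < v1" "v1 < v2" and \<alpha>s: "\<alpha>s \<in> {0..1}" and \<beta>: "\<beta> \<in> {0..1}" "\<beta> \<noteq> 1"
    and t: "t = (v1 / v2 - \<beta> / 2) / (1 - \<beta>)" "t \<in> {0..1}"
  shows "achievable v1 v2 \<beta> \<alpha>s = F ` payoff_region t \<alpha>s"
proof -
  let ?u = "\<lambda>\<sigma> \<phi>.
    (\<Sum>\<alpha>\<in>set_pmf \<sigma>. pmf \<sigma> \<alpha> * expected_consumer_utility v1 v2 \<beta> \<phi> \<alpha>,
     \<Sum>\<alpha>\<in>set_pmf \<sigma>. pmf \<sigma> \<alpha> * expected_producer_utility v1 v2 \<beta> \<phi> \<alpha>)"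
  let ?wm = "\<lambda>\<sigma> r. (\<Sum>\<alpha>\<in>set_pmf \<sigma>. pmf \<sigma> \<alpha> * (r \<alpha> * \<alpha>), \<Sum>\<alpha>\<in>set_pmf \<sigma>. pmf \<sigma> \<alpha> * r \<alpha>)"
  \<comment> \<open>Stated for any \<open>r\<close> agreeing with the low-price probability on the
    unit interval, so that it serves both inclusions: \<open>r\<close> read off from \<phi>, and
    \<phi> built from \<open>r\<close>.\<close>
  have utility: "?u \<sigma> \<phi> = F (?wm \<sigma> r)"
    if \<sigma>: "\<sigma> \<in> segmentations v1 v2 \<alpha>s" and \<phi>: "optimal_pricing_rule v1 v2 \<beta> \<phi>"
      and r: "\<And>\<alpha>. \<alpha> \<in> {0..1} \<Longrightarrow> pmf (\<phi> \<alpha>) v1 = r \<alpha>" for \<sigma> \<phi> r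
  proof -
    have fin: "finite (set_pmf \<sigma>)" and sub: "set_pmf \<sigma> \<subseteq> {0..1}"
      and mean: "(\<Sum>\<alpha>\<in>set_pmf \<sigma>. pmf \<sigma> \<alpha> * \<alpha>) = \<alpha>s"
      using \<sigma> segmentations_iff[OF v(2) \<alpha>s] by auto
    have total: "(\<Sum>\<alpha>\<in>set_pmf \<sigma>. pmf \<sigma> \<alpha>) = 1"
      using fin by (intro sum_pmf_eq_1) auto
    have prices: "\<And>\<alpha>. \<alpha> \<in> {0..1} \<Longrightarrow> set_pmf (\<phi> \<alpha>) \<subseteq> {v1, v2}"
      using \<phi> by (simp add: optimal_pricing_rule_def)
    note integral = integral_mechanism_two_prices[OF v(2) \<beta>(1) _ t(2) prices
        threshold_rule_of_pricing_rule[OF v \<beta> t(1) \<phi>]]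
    \<comment> \<open>Both utilities are written as combinations of 1, \<alpha>,
      \<open>r \<alpha>\<close> and \<open>r \<alpha> * \<alpha>\<close>, whose averages are 1,
      \<open>\<alpha>s\<close>, \<open>m\<close> and \<open>w\<close>.\<close>
    have cons: "expected_consumer_utility v1 v2 \<beta> \<phi> \<alpha> =
        \<beta> * t * (v2 - v1) * \<alpha> + (1 - \<beta>) * (v2 - v1) * (r \<alpha> * \<alpha>)" if "\<alpha> \<in> set_pmf \<sigma>" for \<alpha>
    proof -
      have \<alpha>: "\<alpha> \<in> {0..1}" using sub that by blast
      then show ?thesis
        unfolding expected_consumer_utility_def using v
        by (subst integral) (auto simp: consumer_utility_market r algebra_simps mult_left_mono)
    qed
    have prod: "expected_producer_utility v1 v2 \<beta> \<phi> \<alpha> =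
        \<beta> * t * v1 + (\<beta> * (1 - t) * v2 + (1 - \<beta>) * v2) * \<alpha> + (1 - \<beta>) * v1 * r \<alpha> - (1 - \<beta>) * v2 * (r \<alpha> * \<alpha>)"
      if "\<alpha> \<in> set_pmf \<sigma>" for \<alpha>
    proof -
      have \<alpha>: "\<alpha> \<in> {0..1}" using sub that by blast
      then show ?thesis
        unfolding expected_producer_utility_def using v
        by (subst integral) (auto simp: producer_utility_market r algebra_simps)
    qed
    let ?E = "\<lambda>g. \<Sum>\<alpha>\<in>set_pmf \<sigma>. pmf \<sigma> \<alpha> * (g \<alpha> :: real)"
    have scale: "?E (\<lambda>\<alpha>. k * g \<alpha>) = k * ?E g" for k g
      by (simp add: sum_distrib_left mult.left_commute)
    have const: "?E (\<lambda>\<alpha>. k) = k" for k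
      using scale[of k "\<lambda>_. 1"] total by simp
    have "?E (expected_consumer_utility v1 v2 \<beta> \<phi>) =
        ?E (\<lambda>\<alpha>. \<beta> * t * (v2 - v1) * \<alpha> + (1 - \<beta>) * (v2 - v1) * (r \<alpha> * \<alpha>))"
      by (rule sum.cong) (simp_all add: cons)
    also have "\<dots> = \<beta> * t * (v2 - v1) * \<alpha>s + (1 - \<beta>) * (v2 - v1) * ?E (\<lambda>\<alpha>. r \<alpha> * \<alpha>)"
      by (simp only: distrib_left sum.distrib scale mean)
    finally have c: "?E (expected_consumer_utility v1 v2 \<beta> \<phi>) = \<dots>" .
    have "?E (expected_producer_utility v1 v2 \<beta> \<phi>) =
        ?E (\<lambda>\<alpha>. \<beta> * t * v1 + (\<beta> * (1 - t) * v2 + (1 - \<beta>) * v2) * \<alpha> +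
          (1 - \<beta>) * v1 * r \<alpha> - (1 - \<beta>) * v2 * (r \<alpha> * \<alpha>))"
      by (rule sum.cong) (simp_all add: prod)
    also have "\<dots> = \<beta> * t * v1 + (\<beta> * (1 - t) * v2 + (1 - \<beta>) * v2) * \<alpha>s +
        (1 - \<beta>) * v1 * ?E r - (1 - \<beta>) * v2 * ?E (\<lambda>\<alpha>. r \<alpha> * \<alpha>)"
      by (simp only: distrib_left[of "pmf _ _"] right_diff_distrib[of "pmf _ _"]
          sum.distrib sum_subtractf scale const mean)
    finally have p: "?E (expected_producer_utility v1 v2 \<beta> \<phi>) = \<dots>" .
    show ?thesis
      unfolding F_def c p by (simp add: algebra_simps)
  qed
  have "achievable v1 v2 \<beta> \<alpha>s =
      {?u \<sigma> \<phi> | \<sigma> \<phi>. \<sigma> \<in> segmentations v1 v2 \<alpha>s \<and> optimal_pricing_rule v1 v2 \<beta> \<phi>}"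
    by (simp add: achievable_def)
  also have "\<dots> = F ` {?wm \<sigma> r | \<sigma> r. \<sigma> \<in> segmentations v1 v2 \<alpha>s \<and> threshold_rule t r}"
    (is "?L = F ` ?R")
  proof
    show "?L \<subseteq> F ` ?R"
    proof
      fix z assume "z \<in> ?L"
      then obtain \<sigma> \<phi> where "z = ?u \<sigma> \<phi>" "\<sigma> \<in> segmentations v1 v2 \<alpha>s"
        and \<phi>: "optimal_pricing_rule v1 v2 \<beta> \<phi>"
        by blast
      then have "z = F (?wm \<sigma> (\<lambda>\<alpha>. pmf (\<phi> \<alpha>) v1))"
        using utility by simp
      then show "z \<in> F ` ?R"
        using \<open>\<sigma> \<in> _\<close> threshold_rule_of_pricing_rule[OF v \<beta> t(1) \<phi>]
        by (intro image_eqI CollectI exI conjI) auto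
    qed
    show "F ` ?R \<subseteq> ?L"
    proof
      fix z assume "z \<in> F ` ?R"
      then obtain \<sigma> r where z: "z = F (?wm \<sigma> r)" and \<sigma>: "\<sigma> \<in> segmentations v1 v2 \<alpha>s"
        and r: "threshold_rule t r"
        by blast
      obtain \<phi> where \<phi>: "optimal_pricing_rule v1 v2 \<beta> \<phi>"
        "\<And>\<alpha>. \<alpha> \<in> {0..1} \<Longrightarrow> pmf (\<phi> \<alpha>) v1 = r \<alpha>"
        using pricing_rule_of_threshold_rule[OF v \<beta> t(1) r] by blast
      then have "z = ?u \<sigma> \<phi>"
        using z utility[OF \<sigma> \<phi>] by simp
      then show "z \<in> ?L"
        using \<sigma> \<phi>(1) by blast
    qed
  qed
  also have "?R = payoff_region t \<alpha>s"
    using payoff_region_eq[OF v(2) t(2) \<alpha>s] by simp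
  finally show ?thesis .
qed

theorem theorem1:
  fixes v1 v2 \<eta> \<beta> \<alpha>s t :: real and c A' B' C' A B C :: "real \<times> real"
  assumes "0 < v1" and "v1 < v2"
    and "\<alpha>s \<in> {0..1}"
    and "\<eta> = v1 / v2"
    and "\<beta> \<in> {0..1}" and "\<beta> \<noteq> 1"
    and "\<beta> \<le> min (2 * \<eta>) (2 * (1 - \<eta>))"
    and "t = (\<eta> - \<beta> / 2) / (1 - \<beta>)"
    and "c = (t * \<alpha>s * (v2 - v1), t * v1 + (1 - t) * \<alpha>s * v2)"
    and "A' = (0, \<alpha>s * v2 + v1 * (max (t - \<alpha>s) 0 / t))"
    and "B' = (0, \<alpha>s * v2 + (1 - \<alpha>s) * v1)"
    and "C' = (\<alpha>s * (v2 - v1) - (v2 - v1) * (max (\<alpha>s - t) 0 / (1 - t)),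
               v1 + (v2 - v1) * (max (\<alpha>s - t) 0 / (1 - t)))"
    and "A = \<beta> *\<^sub>R c + (1 - \<beta>) *\<^sub>R A'"
    and "B = \<beta> *\<^sub>R c + (1 - \<beta>) *\<^sub>R B'"
    and "C = \<beta> *\<^sub>R c + (1 - \<beta>) *\<^sub>R C'"
  shows "achievable v1 v2 \<beta> \<alpha>s = convex hull {A, B, C}"
proof -
  have \<beta>: "\<beta> < 1"
    using assms(5,6) by auto
  \<comment> \<open>\<open>\<beta> \<le> 2 * \<eta>\<close> makes the numerator nonnegative, and
    \<open>\<beta> \<le> 2 * (1 - \<eta>)\<close> keeps it at most
    \<open>1 - \<beta>\<close>.\<close>
  have t01: "t \<in> {0..1}"
    using assms(7) \<beta> by (simp add: assms(8) divide_le_eq_1)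
  \<comment> \<open>The affine map is split into its linear part \<open>L\<close> and its value
    \<open>z\<close> at the origin, because convex hulls commute with linear images and with
    translations.\<close>
  define L where "L = (\<lambda>(w, m). ((1 - \<beta>) * (w * (v2 - v1)), (1 - \<beta>) * (m * v1 - w * v2)))"
  define z where "z = \<beta> *\<^sub>R c + (1 - \<beta>) *\<^sub>R (0, \<alpha>s * v2)"
  have "linear L"
    unfolding L_def by (rule linearI) (auto simp: algebra_simps)
  have "achievable v1 v2 \<beta> \<alpha>s = (\<lambda>x. z + L x) ` payoff_region t \<alpha>s"
    unfolding achievable_eq_image[OF assms(1,2,3,5,6) assms(8)[unfolded assms(4)] t01]
    by (rule image_cong) (auto simp: z_def L_def assms(9) algebra_simps)
  also have "\<dots> = (\<lambda>x. z + x) ` L ` payoff_region t \<alpha>s"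
    by (simp add: image_image)
  also have "\<dots> = convex hull ((\<lambda>x. z + x) ` L ` {(0, max (t - \<alpha>s) 0 / t), (0, 1 - \<alpha>s),
      (\<alpha>s - max (\<alpha>s - t) 0 / (1 - t), 1 - max (\<alpha>s - t) 0 / (1 - t))})"
    unfolding payoff_region_eq_hull[OF t01 assms(3) refl refl]
      convex_hull_linear_image[OF \<open>linear L\<close>] convex_hull_translation ..
  also have "(\<lambda>x. z + x) ` L ` {(0, max (t - \<alpha>s) 0 / t), (0, 1 - \<alpha>s),
      (\<alpha>s - max (\<alpha>s - t) 0 / (1 - t), 1 - max (\<alpha>s - t) 0 / (1 - t))} = {A, B, C}"
  proof -
    have "A = z + L (0, Y)" if "Y = max (t - \<alpha>s) 0 / t" for Y
      unfolding assms(10,13) that[symmetric] by (simp add: z_def L_def algebra_simps)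
    moreover have "B = z + L (0, 1 - \<alpha>s)"
      by (simp add: z_def L_def assms(11,14) algebra_simps)
    moreover have "C = z + L (\<alpha>s - X, 1 - X)" if "X = max (\<alpha>s - t) 0 / (1 - t)" for X
      unfolding assms(12,15) that[symmetric] by (simp add: z_def L_def algebra_simps)
    ultimately show ?thesis by simp
  qed
  finally show ?thesis .
qed

end
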